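(* Let $\Phi:\mathbb{M}(n)\to\mathbb{M}(k)$ be a positive unital linear map. Let $A\in\mathbb{M}(n)$ be a positive definite matrix and let $0<m\le M$ be real numbers with $mI\le A\le MI$. Then $$\left(\frac{m}{M}\right)^{\frac{n-1}{n}}I\le(\det A)^{-\frac1n}\,\Phi(A)\le\left(\frac{M}{m}\right)^{\frac{n-1}{n}}I.$$
   Context: $\mathbb{M}(n)$ is the algebra of all $n\times n$ complex matrices. A linear map $\Phi:\mathbb{M}(n)\to\mathbb{M}(k)$ is positive if $\Phi(A)$ is positive semidefinite whenever $A$ is positive semidefinite, and unital if $\Phi(I)=I$. For Hermitian matrices, $X\le Y$ means that $Y-X$ is positive semidefinite (Loewner order). *)

theory Defs
  imports
    "Jordan_Normal_Form.Schur_Decomposition"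
    "HOL-Analysis.Complex_Transcendental"
begin

text \<open>The algebra of all \<open>n \<times> n\<close> complex matrices is \<open>carrier_mat n n\<close>.
  In the library \<open>u \<bullet>c v\<close> is linear in \<open>u\<close> and conjugate-linear in \<open>v\<close>, so
  \<open>(A *\<^sub>v v) \<bullet>c v\<close> is the quadratic form \<open>v\<^sup>* A v\<close>; it is real because \<open>A\<close> is Hermitian.\<close>

definition hermitian_mat :: "nat \<Rightarrow> complex mat \<Rightarrow> bool" where
  "hermitian_mat n A \<longleftrightarrow> A \<in> carrier_mat n n \<and> mat_adjoint A = A"

definition psd_mat :: "nat \<Rightarrow> complex mat \<Rightarrow> bool" where
  "psd_mat n A \<longleftrightarrow> hermitian_mat n A \<and> (\<forall>v\<in>carrier_vec n. 0 \<le> Re ((A *\<^sub>v v) \<bullet>c v))"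

definition pd_mat :: "nat \<Rightarrow> complex mat \<Rightarrow> bool" where
  "pd_mat n A \<longleftrightarrow> hermitian_mat n A \<and>
     (\<forall>v\<in>carrier_vec n. v \<noteq> 0\<^sub>v n \<longrightarrow> 0 < Re ((A *\<^sub>v v) \<bullet>c v))"

definition loewner_le :: "nat \<Rightarrow> complex mat \<Rightarrow> complex mat \<Rightarrow> bool" where
  "loewner_le n X Y \<longleftrightarrow> hermitian_mat n X \<and> hermitian_mat n Y \<and> psd_mat n (Y - X)"

definition linear_mat_map :: "nat \<Rightarrow> nat \<Rightarrow> (complex mat \<Rightarrow> complex mat) \<Rightarrow> bool" where
  "linear_mat_map n k \<Phi> \<longleftrightarrow>
     (\<forall>A\<in>carrier_mat n n. \<Phi> A \<in> carrier_mat k k) \<and>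
     (\<forall>A\<in>carrier_mat n n. \<forall>B\<in>carrier_mat n n. \<Phi> (A + B) = \<Phi> A + \<Phi> B) \<and>
     (\<forall>c. \<forall>A\<in>carrier_mat n n. \<Phi> (c \<cdot>\<^sub>m A) = c \<cdot>\<^sub>m \<Phi> A)"

definition positive_mat_map :: "nat \<Rightarrow> nat \<Rightarrow> (complex mat \<Rightarrow> complex mat) \<Rightarrow> bool" where
  "positive_mat_map n k \<Phi> \<longleftrightarrow> (\<forall>A. psd_mat n A \<longrightarrow> psd_mat k (\<Phi> A))"

definition unital_mat_map :: "nat \<Rightarrow> nat \<Rightarrow> (complex mat \<Rightarrow> complex mat) \<Rightarrow> bool" where
  "unital_mat_map n k \<Phi> \<longleftrightarrow> \<Phi> (1\<^sub>m n) = 1\<^sub>m k"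

end

theory Submission
  imports Defs
begin

text \<open>A positive unital map preserves the bounds \<open>s I \<le> A \<le> t I\<close>, so it suffices to compare the extreme
  eigenvalues \<open>s\<close> and \<open>t\<close> of \<open>A\<close> with \<open>det A\<close>, the product of all eigenvalues:
  \<open>t m\<^sup>n\<^sup>-\<^sup>1 \<le> det A \<le> s M\<^sup>n\<^sup>-\<^sup>1\<close>. No unitary diagonalisation is needed: for the supremum \<open>s\<close> of all \<open>r\<close> with
  \<open>r I \<le> A\<close>, the matrix \<open>A - s I\<close> is singular, since a nonsingular positive semidefinite matrix
  dominates \<open>e I\<close> for some \<open>e > 0\<close>. The same argument for \<open>-A\<close> yields \<open>t\<close>.\<close>

section \<open>Hermitian matrices and their quadratic forms\<close>

lemma hermitian_matI:
  assumes "A \<in> carrier_mat n n" and "\<And>i j. i < n \<Longrightarrow> j < n \<Longrightarrow> A $$ (i, j) = cnj (A $$ (j, i))"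
  shows "hermitian_mat n A"
  unfolding hermitian_mat_def
proof (intro conjI eq_matI)
  fix i j assume "i < dim_row A" "j < dim_col A"
  then show "mat_adjoint A $$ (i, j) = A $$ (i, j)"
    using assms(1) assms(2)[of i j] by (simp add: mat_adjoint_def mat_of_rows_index)
qed (use assms(1) in \<open>auto simp: mat_adjoint_def\<close>)

lemma hermitian_mat_index:
  assumes "hermitian_mat n A" "i < n" "j < n"
  shows "A $$ (i, j) = cnj (A $$ (j, i))"
proof -
  have A: "A \<in> carrier_mat n n" and adj: "mat_adjoint A = A"
    using assms(1) by (auto simp: hermitian_mat_def)
  have "mat_adjoint A $$ (i, j) = cnj (A $$ (j, i))"
    using A assms(2,3) by (simp add: mat_adjoint_def mat_of_rows_index)
  then show ?thesis by (simp add: adj)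
qed

lemma mult_mat_vec_cscalar:
  fixes A :: "complex mat"
  assumes "A \<in> carrier_mat n n" "u \<in> carrier_vec n" "v \<in> carrier_vec n"
  shows "(A *\<^sub>v u) \<bullet>c v = (\<Sum>i<n. \<Sum>j<n. A $$ (i, j) * vec_index u j * cnj (vec_index v i))"
  using assms
  by (auto simp: scalar_prod_def atLeast0LessThan sum_distrib_right intro!: sum.cong)

lemma cscalar_self:
  fixes v :: "complex Matrix.vec"
  assumes "v \<in> carrier_vec n"
  shows "v \<bullet>c v = complex_of_real (\<Sum>i<n. (cmod (vec_index v i))\<^sup>2)"
  using assms
  by (auto simp: scalar_prod_def atLeast0LessThan intro!: sum.cong simp flip: complex_norm_square)

lemma Re_cscalar_self_pos:
  fixes v :: "complex Matrix.vec"
  assumes v: "v \<in> carrier_vec n" and "v \<noteq> 0\<^sub>v n"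
  shows "0 < Re (v \<bullet>c v)"
proof -
  obtain i where "i < n" "vec_index v i \<noteq> 0"
    using assms by (metis carrier_vecD eq_vecI index_zero_vec)
  then show ?thesis
    unfolding cscalar_self[OF v] by (auto intro!: sum_pos2[of _ i])
qed

lemma Re_cscalar_self_nonneg:
  fixes v :: "complex Matrix.vec"
  assumes "v \<in> carrier_vec n"
  shows "0 \<le> Re (v \<bullet>c v)"
  unfolding cscalar_self[OF assms] by (auto intro!: sum_nonneg)

text \<open>Self-adjointness for the sesquilinear form. With \<open>u = v\<close> it makes the
  quadratic form real; with \<open>u\<close> and \<open>v\<close> distinct it evaluates the cross
  term in the gap argument for nonsingular matrices.\<close>

lemma hermitian_form_cnj:
  assumes H: "hermitian_mat n A" and u: "u \<in> carrier_vec n" and v: "v \<in> carrier_vec n"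
  shows "(A *\<^sub>v u) \<bullet>c v = cnj ((A *\<^sub>v v) \<bullet>c u)"
proof -
  have A: "A \<in> carrier_mat n n" using H by (simp add: hermitian_mat_def)
  have "cnj ((A *\<^sub>v v) \<bullet>c u) =
      (\<Sum>i<n. \<Sum>j<n. A $$ (j, i) * vec_index u i * cnj (vec_index v j))"
    unfolding mult_mat_vec_cscalar[OF A v u]
    by (auto intro!: sum.cong simp: hermitian_mat_index[OF H, symmetric])
  also have "\<dots> = (\<Sum>j<n. \<Sum>i<n. A $$ (j, i) * vec_index u i * cnj (vec_index v j))"
    by (rule sum.swap)
  finally show ?thesis by (simp add: mult_mat_vec_cscalar[OF A u v])
qed

text \<open>A crude bound by the entries suffices, since only the existence of some \<open>K\<close>
  matters. The summand 1 in \<open>K\<close> keeps it positive when all entries vanish, so that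
  \<open>1 / K\<close> can serve as a gap.\<close>

lemma quadratic_form_le:
  fixes A :: "complex mat"
  assumes A: "A \<in> carrier_mat n n"
  obtains K where "0 < K" "\<And>v. v \<in> carrier_vec n \<Longrightarrow> \<bar>Re ((A *\<^sub>v v) \<bullet>c v)\<bar> \<le> K * Re (v \<bullet>c v)"
proof
  define K where "K = 1 + (\<Sum>i<n. \<Sum>j<n. cmod (A $$ (i, j)))"
  show "0 < K" unfolding K_def by (intro add_pos_nonneg sum_nonneg) auto
  fix v :: "complex Matrix.vec" assume v: "v \<in> carrier_vec n"
  define N where "N = Re (v \<bullet>c v)"
  have N: "N = (\<Sum>i<n. (cmod (vec_index v i))\<^sup>2)"
    unfolding N_def cscalar_self[OF v] by simp
  have N0: "0 \<le> N" unfolding N by (intro sum_nonneg) auto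
  have entry: "(cmod (vec_index v i))\<^sup>2 \<le> N" if "i < n" for i
    unfolding N using that by (intro member_le_sum) auto
  \<comment> \<open>Twice the product is at most the sum of the two squares, and each square is at
    most \<open>N\<close>.\<close>
  have le: "cmod (vec_index v j) * cmod (vec_index v i) \<le> N" if "i < n" "j < n" for i j
  proof -
    have "0 \<le> (cmod (vec_index v j) - cmod (vec_index v i))\<^sup>2" by simp
    then show ?thesis
      using entry[OF that(1)] entry[OF that(2)] by (simp add: power2_diff)
  qed
  have "\<bar>Re ((A *\<^sub>v v) \<bullet>c v)\<bar> \<le> cmod ((A *\<^sub>v v) \<bullet>c v)" by (rule abs_Re_le_cmod)
  also have "\<dots> \<le> (\<Sum>i<n. \<Sum>j<n. cmod (A $$ (i, j) * vec_index v j * cnj (vec_index v i)))"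
    unfolding mult_mat_vec_cscalar[OF A v v]
    by (rule order_trans[OF norm_sum sum_mono]) (rule norm_sum)
  also have "\<dots> \<le> (\<Sum>i<n. \<Sum>j<n. cmod (A $$ (i, j)) * N)"
    by (intro sum_mono) (auto simp: norm_mult mult.assoc intro!: mult_left_mono le)
  also have "\<dots> = (K - 1) * N" by (simp add: K_def sum_distrib_right)
  also have "\<dots> \<le> K * N" using N0 by (simp add: algebra_simps)
  finally show "\<bar>Re ((A *\<^sub>v v) \<bullet>c v)\<bar> \<le> K * Re (v \<bullet>c v)" by (simp add: N_def)
qed

section \<open>A spectral gap for nonsingular positive semidefinite matrices\<close>

lemma minus_smult_one_mult_vec:
  fixes A :: "complex mat"
  assumes A: "A \<in> carrier_mat n n" and u: "u \<in> carrier_vec n"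
  shows "(A - c \<cdot>\<^sub>m 1\<^sub>m n) *\<^sub>v u = A *\<^sub>v u - c \<cdot>\<^sub>v u"
  using assms by (subst minus_mult_distrib_mat_vec[of _ n n]) auto

text \<open>With \<open>x = C v\<close> and \<open>t = 1 / K\<close>, where \<open>C\<close> is the inverse and \<open>K\<close> bounds its quadratic form,
  the bound is the inequality \<open>(v - t x)\<^sup>* B (v - t x) \<ge> 0\<close> expanded.\<close>
lemma psd_mat_nonsingular_gap:
  assumes P: "psd_mat n B" and det: "det B \<noteq> 0"
  obtains e where "0 < e" "\<And>v. v \<in> carrier_vec n \<Longrightarrow> e * Re (v \<bullet>c v) \<le> Re ((B *\<^sub>v v) \<bullet>c v)"
proof -
  have H: "hermitian_mat n B" and B: "B \<in> carrier_mat n n"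
    and pos: "\<And>v. v \<in> carrier_vec n \<Longrightarrow> 0 \<le> Re ((B *\<^sub>v v) \<bullet>c v)"
    using P by (auto simp: psd_mat_def hermitian_mat_def)
  \<comment> \<open>The \<open>()\<close> merely fills the extension slot of the matrix ring record;
    of the unit property only the right inverse is kept.\<close>
  from det_non_zero_imp_unit[OF B det, of "()"]
  obtain C where C: "C \<in> carrier_mat n n" and BC: "B * C = 1\<^sub>m n"
    by (auto simp: Units_def ring_mat_simps)
  obtain K where K: "0 < K" "\<And>v. v \<in> carrier_vec n \<Longrightarrow> \<bar>Re ((C *\<^sub>v v) \<bullet>c v)\<bar> \<le> K * Re (v \<bullet>c v)"
    using quadratic_form_le[OF C] by blast
  show thesis
  proof
    show "0 < 1 / K" using K by simp
    fix v :: "complex Matrix.vec" assume v: "v \<in> carrier_vec n"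
    define x where "x = C *\<^sub>v v"
    have x: "x \<in> carrier_vec n" using C v by (simp add: x_def)
    have Bx: "B *\<^sub>v x = v"
      using assoc_mult_mat_vec[OF B C v] v by (simp add: x_def BC)
    \<comment> \<open>The value \<open>1 / K\<close> minimises \<open>K * t^2 - 2 * t\<close>, the
      coefficient left after bounding the form of \<open>C\<close> by \<open>K\<close>. Being real,
      \<open>t\<close> passes unchanged through conjugation.\<close>
    define t where "t = complex_of_real (1 / K)"
    define w where "w = v - t \<cdot>\<^sub>v x"
    have w: "w \<in> carrier_vec n" using v x by (simp add: w_def)
    have Bw: "B *\<^sub>v w = B *\<^sub>v v - t \<cdot>\<^sub>v v"
      unfolding w_def using B v x Bx
      by (simp add: mult_minus_distrib_mat_vec[of _ n n] mult_mat_vec[of _ n n])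
    have cw: "conjugate w = conjugate v - t \<cdot>\<^sub>v conjugate x"
      unfolding w_def using v x by (auto simp: t_def)
    have Bv: "B *\<^sub>v v \<in> carrier_vec n" using B v by simp
    have expand: "(B *\<^sub>v w) \<bullet>c w =
        (B *\<^sub>v v) \<bullet>c v - t * ((B *\<^sub>v v) \<bullet>c x) - t * (v \<bullet>c v) + t * t * (v \<bullet>c x)"
      unfolding Bw cw using v x Bv
      by (simp add: minus_scalar_prod_distrib[of _ n] scalar_prod_minus_distrib[of _ n] algebra_simps)
    \<comment> \<open>Moving \<open>B\<close> to the other side meets \<open>B x = v\<close>, so
      both cross terms have the real part of \<open>v \<bullet>c v\<close>.\<close>
    have Bvx: "(B *\<^sub>v v) \<bullet>c x = cnj (v \<bullet>c v)"
      using hermitian_form_cnj[OF H v x] Bx by simp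
    have "v \<bullet>c x = cnj (x \<bullet>c v)"
      using v x by (auto simp: scalar_prod_def intro!: sum.cong)
    then have vx: "Re (v \<bullet>c x) = Re ((C *\<^sub>v v) \<bullet>c v)" by (simp add: x_def)
    have "0 \<le> Re ((B *\<^sub>v w) \<bullet>c w)" by (rule pos[OF w])
    also have "\<dots> = Re ((B *\<^sub>v v) \<bullet>c v) - 2 * (1 / K) * Re (v \<bullet>c v)
        + (1 / K) * (1 / K) * Re ((C *\<^sub>v v) \<bullet>c v)"
      unfolding expand Bvx vx[symmetric] t_def by simp
    also have "\<dots> \<le> Re ((B *\<^sub>v v) \<bullet>c v) - 2 * (1 / K) * Re (v \<bullet>c v)
        + (1 / K) * (1 / K) * (K * Re (v \<bullet>c v))"
      using K(2)[OF v] K(1) by (intro add_left_mono mult_left_mono) auto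
    also have "\<dots> = Re ((B *\<^sub>v v) \<bullet>c v) - 1 / K * Re (v \<bullet>c v)"
      using K(1) by (simp add: field_simps)
    finally show "1 / K * Re (v \<bullet>c v) \<le> Re ((B *\<^sub>v v) \<bullet>c v)" by simp
  qed
qed

section \<open>The Loewner order and the least eigenvalue\<close>

lemma hermitian_mat_one: "hermitian_mat n (complex_of_real r \<cdot>\<^sub>m 1\<^sub>m n)"
  by (rule hermitian_matI) auto

lemma hermitian_mat_smult:
  assumes "hermitian_mat n A"
  shows "hermitian_mat n (complex_of_real r \<cdot>\<^sub>m A)"
proof (rule hermitian_matI)
  have A: "A \<in> carrier_mat n n"
    using assms by (simp add: hermitian_mat_def)
  then show "complex_of_real r \<cdot>\<^sub>m A \<in> carrier_mat n n" by simp
  fix i j assume "i < n" "j < n"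
  with A show "(complex_of_real r \<cdot>\<^sub>m A) $$ (i, j) = cnj ((complex_of_real r \<cdot>\<^sub>m A) $$ (j, i))"
    using hermitian_mat_index[OF assms, of i j] by simp
qed

lemma hermitian_mat_minus:
  assumes "hermitian_mat n A" "hermitian_mat n B"
  shows "hermitian_mat n (A - B)"
proof (rule hermitian_matI)
  have A: "A \<in> carrier_mat n n" and B: "B \<in> carrier_mat n n"
    using assms by (auto simp: hermitian_mat_def)
  show "A - B \<in> carrier_mat n n" using B by (rule minus_carrier_mat)
  fix i j assume "i < n" "j < n"
  with A B show "(A - B) $$ (i, j) = cnj ((A - B) $$ (j, i))"
    using hermitian_mat_index[OF assms(1), of i j] hermitian_mat_index[OF assms(2), of i j] by simp
qed

text \<open>For Hermitian sides only positivity of the difference is left to check, and the form is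
  additive in the matrix. This turns the later order arguments into inequalities between
  reals.\<close>

lemma loewner_le_iff:
  assumes X: "hermitian_mat n X" and Y: "hermitian_mat n Y"
  shows "loewner_le n X Y \<longleftrightarrow>
    (\<forall>v\<in>carrier_vec n. Re ((X *\<^sub>v v) \<bullet>c v) \<le> Re ((Y *\<^sub>v v) \<bullet>c v))"
proof -
  have "Re (((Y - X) *\<^sub>v v) \<bullet>c v) = Re ((Y *\<^sub>v v) \<bullet>c v) - Re ((X *\<^sub>v v) \<bullet>c v)"
    if v: "v \<in> carrier_vec n" for v
  proof -
    have "X \<in> carrier_mat n n" "Y \<in> carrier_mat n n"
      using X Y by (auto simp: hermitian_mat_def)
    with v show ?thesis
      by (simp add: minus_mult_distrib_mat_vec[of _ n n] minus_scalar_prod_distrib[of _ n])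
  qed
  then show ?thesis
    unfolding loewner_le_def psd_mat_def using X Y hermitian_mat_minus[OF Y X] by auto
qed

lemma smult_mat_quadratic_form:
  fixes A :: "complex mat"
  assumes "A \<in> carrier_mat n n" "v \<in> carrier_vec n"
  shows "Re (((complex_of_real r \<cdot>\<^sub>m A) *\<^sub>v v) \<bullet>c v) = r * Re ((A *\<^sub>v v) \<bullet>c v)"
proof -
  have "(complex_of_real r \<cdot>\<^sub>m A) *\<^sub>v v = complex_of_real r \<cdot>\<^sub>v (A *\<^sub>v v)"
    using assms by (intro eq_vecI) auto
  moreover have "A *\<^sub>v v \<in> carrier_vec n" using assms by simp
  ultimately show ?thesis using assms(2) by simp
qed

lemma one_mat_quadratic_form:
  assumes "v \<in> carrier_vec n"
  shows "Re (((complex_of_real r \<cdot>\<^sub>m 1\<^sub>m n) *\<^sub>v v) \<bullet>c v) = r * Re (v \<bullet>c v)"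
  using assms by (subst smult_mat_quadratic_form[OF one_carrier_mat]) auto

text \<open>The infimum of the Rayleigh quotient is formed as the supremum of its lower bounds;
  \<open>psd_mat_nonsingular_gap\<close> replaces compactness of the unit sphere in showing that it
  is attained.\<close>

lemma rayleigh_infimum_eigenvalue:
  assumes H: "hermitian_mat n A" and n: "0 < n"
  obtains s where "loewner_le n (complex_of_real s \<cdot>\<^sub>m 1\<^sub>m n) A" "eigenvalue A (complex_of_real s)"
proof -
  have A: "A \<in> carrier_mat n n" using H by (simp add: hermitian_mat_def)
  define S where "S = {t. \<forall>v\<in>carrier_vec n. t * Re (v \<bullet>c v) \<le> Re ((A *\<^sub>v v) \<bullet>c v)}"
  define s where "s = Sup S"
  obtain K where K: "\<And>v. v \<in> carrier_vec n \<Longrightarrow> \<bar>Re ((A *\<^sub>v v) \<bullet>c v)\<bar> \<le> K * Re (v \<bullet>c v)"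
    using quadratic_form_le[OF A] by blast
  have "- K \<in> S"
    unfolding S_def using K by (simp add: abs_le_iff minus_le_iff)
  then have ne: "S \<noteq> {}" by blast
  have le_quot: "t \<le> Re ((A *\<^sub>v v) \<bullet>c v) / Re (v \<bullet>c v)"
    if "t \<in> S" "v \<in> carrier_vec n" "v \<noteq> 0\<^sub>v n" for t v
    using that Re_cscalar_self_pos[OF that(2,3)] by (simp add: S_def pos_le_divide_eq)
  \<comment> \<open>Here \<open>0 < n\<close> enters: the quotient at one nonzero vector bounds
    \<open>S\<close> above, so that its supremum is meaningful.\<close>
  have "unit_vec n 0 \<noteq> (0\<^sub>v n :: complex Matrix.vec)"
    using n by (metis index_unit_vec(1) index_zero_vec(1) zero_neq_one)
  then have bdd: "bdd_above S"
    using le_quot[OF _ unit_vec_carrier] by (intro bdd_aboveI)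
  have "s * Re (v \<bullet>c v) \<le> Re ((A *\<^sub>v v) \<bullet>c v)" if v: "v \<in> carrier_vec n" for v
  proof (cases "v = 0\<^sub>v n")
    case True
    then show ?thesis using A by simp
  next
    case False
    then have "s \<le> Re ((A *\<^sub>v v) \<bullet>c v) / Re (v \<bullet>c v)"
      unfolding s_def using le_quot v by (intro cSup_least[OF ne]) auto
    then show ?thesis
      using Re_cscalar_self_pos[OF v False] by (simp add: pos_le_divide_eq)
  qed
  then have le: "loewner_le n (complex_of_real s \<cdot>\<^sub>m 1\<^sub>m n) A"
    by (simp add: loewner_le_iff[OF hermitian_mat_one H] one_mat_quadratic_form)
  define B where "B = A - complex_of_real s \<cdot>\<^sub>m 1\<^sub>m n"
  have B: "B \<in> carrier_mat n n" and psd: "psd_mat n B"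
    using le by (auto simp: B_def loewner_le_def minus_carrier_mat)
  have Bv: "B *\<^sub>v v = A *\<^sub>v v - complex_of_real s \<cdot>\<^sub>v v" if "v \<in> carrier_vec n" for v
    unfolding B_def by (rule minus_smult_one_mult_vec[OF A that])
  have "det B = 0"
  proof (rule ccontr)
    \<comment> \<open>A gap \<open>e\<close> for \<open>B\<close> would make \<open>s + e\<close>
      another lower bound of the quotient, against the choice of \<open>s\<close>.\<close>
    assume "det B \<noteq> 0"
    then obtain e where e: "0 < e"
      "\<And>v. v \<in> carrier_vec n \<Longrightarrow> e * Re (v \<bullet>c v) \<le> Re ((B *\<^sub>v v) \<bullet>c v)"
      using psd_mat_nonsingular_gap[OF psd] by blast
    have "(s + e) * Re (v \<bullet>c v) \<le> Re ((A *\<^sub>v v) \<bullet>c v)" if v: "v \<in> carrier_vec n" for v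
    proof -
      have "Re ((B *\<^sub>v v) \<bullet>c v) = Re ((A *\<^sub>v v) \<bullet>c v) - s * Re (v \<bullet>c v)"
        unfolding Bv[OF v] using A v by (simp add: minus_scalar_prod_distrib[of _ n])
      then show ?thesis using e(2)[OF v] by (simp add: algebra_simps)
    qed
    then have "s + e \<in> S" by (simp add: S_def)
    then have "s + e \<le> s" unfolding s_def by (rule cSup_upper[OF _ bdd])
    then show False using e(1) by simp
  qed
  then obtain v where v: "v \<in> carrier_vec n" "v \<noteq> 0\<^sub>v n" "B *\<^sub>v v = 0\<^sub>v n"
    using det_0_iff_vec_prod_zero[OF B] by blast
  have "A *\<^sub>v v = complex_of_real s \<cdot>\<^sub>v v"
  proof (rule eq_vecI)
    fix i assume "i < dim_vec (complex_of_real s \<cdot>\<^sub>v v)"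
    then show "vec_index (A *\<^sub>v v) i = vec_index (complex_of_real s \<cdot>\<^sub>v v) i"
      using arg_cong[OF v(3)[unfolded Bv[OF v(1)]], of "\<lambda>w. vec_index w i"] v(1) A by simp
  qed (use A v(1) in simp)
  then have "eigenvalue A (complex_of_real s)"
    unfolding eigenvalue_def eigenvector_def using A v by auto
  with le show thesis by (rule that)
qed

section \<open>Real spectrum and determinant of a Hermitian matrix\<close>

lemma hermitian_eigenvalueE:
  assumes H: "hermitian_mat n A" and "eigenvalue A e"
  obtains v where "v \<in> carrier_vec n" "v \<noteq> 0\<^sub>v n" "A *\<^sub>v v = e \<cdot>\<^sub>v v" "e = complex_of_real (Re e)"
    "Re ((A *\<^sub>v v) \<bullet>c v) = Re e * Re (v \<bullet>c v)"
proof -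
  have A: "A \<in> carrier_mat n n" using H by (simp add: hermitian_mat_def)
  then obtain v where v: "v \<in> carrier_vec n" "v \<noteq> 0\<^sub>v n" and Av: "A *\<^sub>v v = e \<cdot>\<^sub>v v"
    using assms(2) by (auto simp: eigenvalue_def eigenvector_def)
  have form: "(A *\<^sub>v v) \<bullet>c v = e * (v \<bullet>c v)" using v(1) by (simp add: Av)
  have real: "v \<bullet>c v = complex_of_real (Re (v \<bullet>c v))"
    using cscalar_self[OF v(1)] by simp
  \<comment> \<open>The form at \<open>v\<close> is its own conjugate; as
    \<open>v \<bullet>c v\<close> is real and positive, \<open>e\<close> must be real.\<close>
  have "e * (v \<bullet>c v) = cnj (e * (v \<bullet>c v))"
    using hermitian_form_cnj[OF H v(1) v(1)] by (simp only: form)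
  then have "Im e * Re (v \<bullet>c v) = 0"
    by (subst (asm) (1 2) real) (simp add: complex_eq_iff)
  then have "Im e = 0" using Re_cscalar_self_pos[OF v] by simp
  then have e: "e = complex_of_real (Re e)" by (simp add: complex_eq_iff)
  have "Re ((A *\<^sub>v v) \<bullet>c v) = Re e * Re (v \<bullet>c v)"
    unfolding form using \<open>Im e = 0\<close> by simp
  with v Av e show thesis by (rule that)
qed

text \<open>Schur triangularisation puts the roots of the characteristic polynomial, with
  multiplicity, on the diagonal, whose product is the determinant. Since these roots are real,
  \<open>es\<close> can be a list of reals.\<close>

lemma hermitian_det_eigenvalues:
  assumes H: "hermitian_mat n A"
  obtains es where "length es = n" "det A = complex_of_real (prod_list es)"
    "\<And>e. e \<in> set es \<longleftrightarrow> eigenvalue A (complex_of_real e)"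
proof -
  have A: "A \<in> carrier_mat n n" using H by (simp add: hermitian_mat_def)
  obtain as where as: "char_poly A = (\<Prod>a\<leftarrow>as. [:- a, 1:])" "length as = n"
    using char_poly_factorized[OF A] by blast
  obtain B P Q where "schur_decomposition A as = (B, P, Q)" by (metis prod_cases3)
  from schur_decomposition[OF A as(1) this]
  have sim: "similar_mat_wit A B P Q" and ut: "upper_triangular B" and diag: "diag_mat B = as"
    by auto
  have B: "B \<in> carrier_mat n n" using similar_mat_witD2[OF A sim] by blast
  have "det A = det B" by (rule det_similar) (use sim in \<open>auto simp: similar_mat_def\<close>)
  then have det: "det A = prod_list as" using det_upper_triangular[OF ut B] diag by simp
  have ev: "a \<in> set as \<longleftrightarrow> eigenvalue A a" for a
    unfolding eigenvalue_root_char_poly[OF A] as(1) poly_prod_list_zero_iff by auto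
  have real: "a = complex_of_real (Re a)" if "a \<in> set as" for a
    using hermitian_eigenvalueE[OF H] ev that by metis
  then have as_map: "as = map complex_of_real (map Re as)"
    by (simp add: map_idI real[symmetric])
  have prod: "prod_list (map complex_of_real xs) = complex_of_real (prod_list xs)" for xs
    by (induction xs) auto
  show thesis
  proof
    show "length (map Re as) = n" using as(2) by simp
    show "det A = complex_of_real (prod_list (map Re as))"
      unfolding prod[symmetric] as_map[symmetric] by (rule det)
    fix e show "e \<in> set (map Re as) \<longleftrightarrow> eigenvalue A (complex_of_real e)"
      unfolding ev[symmetric] by (metis (no_types) Re_complex_of_real imageE image_eqI list.set_map real)
  qed
qed

section \<open>Bounding the determinant by an extreme eigenvalue\<close>

lemma prod_list_bounds:
  fixes xs :: "real list"
  assumes "0 \<le> m" "\<And>x. x \<in> set xs \<Longrightarrow> m \<le> x \<and> x \<le> M"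
  shows "m ^ length xs \<le> prod_list xs \<and> prod_list xs \<le> M ^ length xs"
  using assms(2)
proof (induction xs)
  case (Cons x xs)
  then have IH: "m ^ length xs \<le> prod_list xs" "prod_list xs \<le> M ^ length xs" "m \<le> x" "x \<le> M"
    by auto
  moreover have "0 \<le> m ^ length xs" using assms(1) by simp
  then have "0 \<le> prod_list xs" using IH(1) by linarith
  ultimately show ?case using assms(1) by (auto intro!: mult_mono)
qed simp

text \<open>One occurrence of \<open>s\<close> is kept as a factor and only the others are
  estimated. Saving this one factor is what lowers the final exponent from 1 to
  \<open>(n - 1) / n\<close>.\<close>

lemma prod_list_bounds_member:
  fixes xs :: "real list"
  assumes m: "0 \<le> m" and b: "\<And>x. x \<in> set xs \<Longrightarrow> m \<le> x \<and> x \<le> M" and s: "s \<in> set xs"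
  shows "s * m ^ (length xs - 1) \<le> prod_list xs" "prod_list xs \<le> s * M ^ (length xs - 1)"
proof -
  obtain ys zs where xs: "xs = ys @ s # zs" using s by (meson split_list)
  have "m ^ length (ys @ zs) \<le> prod_list (ys @ zs) \<and> prod_list (ys @ zs) \<le> M ^ length (ys @ zs)"
    using b by (intro prod_list_bounds[OF m]) (auto simp: xs)
  moreover have "prod_list xs = s * prod_list (ys @ zs)" "length xs - 1 = length (ys @ zs)"
    by (auto simp: xs)
  moreover have "0 \<le> s" using m b[OF s] by simp
  ultimately show "s * m ^ (length xs - 1) \<le> prod_list xs" "prod_list xs \<le> s * M ^ (length xs - 1)"
    by (auto intro: mult_left_mono)
qed

text \<open>Here \<open>s\<close> and \<open>t\<close> are the least and greatest eigenvalues. The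
  lower bound \<open>s\<close> of \<open>A\<close> is paired with an upper bound of
  \<open>d\<close>, and \<open>t\<close> with a lower bound, as the factor
  \<open>d powr (- (1 / n))\<close> decreases in \<open>d\<close>.\<close>

lemma extreme_eigenvalues_det_bounds:
  assumes n: "0 < n" and m: "0 < m"
    and lo: "loewner_le n (complex_of_real m \<cdot>\<^sub>m 1\<^sub>m n) A"
    and up: "loewner_le n A (complex_of_real M \<cdot>\<^sub>m 1\<^sub>m n)"
  obtains d s t where "det A = complex_of_real d" "m \<le> s" "m \<le> t" "t \<le> M"
    "loewner_le n (complex_of_real s \<cdot>\<^sub>m 1\<^sub>m n) A" "loewner_le n A (complex_of_real t \<cdot>\<^sub>m 1\<^sub>m n)"
    "d \<le> s * M ^ (n - 1)" "t * m ^ (n - 1) \<le> d"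
proof -
  have H: "hermitian_mat n A" using lo by (simp add: loewner_le_def)
  then have A: "A \<in> carrier_mat n n" by (simp add: hermitian_mat_def)
  obtain es where es: "length es = n" "det A = complex_of_real (prod_list es)"
    and ev: "\<And>e. e \<in> set es \<longleftrightarrow> eigenvalue A (complex_of_real e)"
    using hermitian_det_eigenvalues[OF H] by blast
  have bounds: "m \<le> e \<and> e \<le> M" if "e \<in> set es" for e
  proof -
    have "eigenvalue A (complex_of_real e)" using that ev by simp
    then obtain v where
      v: "v \<in> carrier_vec n" "v \<noteq> 0\<^sub>v n" "Re ((A *\<^sub>v v) \<bullet>c v) = e * Re (v \<bullet>c v)"
      using hermitian_eigenvalueE[OF H] by (metis Re_complex_of_real)
    have "m * Re (v \<bullet>c v) \<le> Re ((A *\<^sub>v v) \<bullet>c v)" "Re ((A *\<^sub>v v) \<bullet>c v) \<le> M * Re (v \<bullet>c v)"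
      using lo up v(1)
      by (auto simp: loewner_le_iff[OF hermitian_mat_one H] loewner_le_iff[OF H hermitian_mat_one]
          one_mat_quadratic_form)
    then show ?thesis using Re_cscalar_self_pos[OF v(1,2)] by (simp add: v(3))
  qed
  obtain s where s: "loewner_le n (complex_of_real s \<cdot>\<^sub>m 1\<^sub>m n) A" "eigenvalue A (complex_of_real s)"
    using rayleigh_infimum_eigenvalue[OF H n] .
  then have "s \<in> set es" by (simp add: ev)
  \<comment> \<open>The greatest eigenvalue of \<open>A\<close> is minus the least eigenvalue of
    \<open>-A\<close>.\<close>
  define N where "N = complex_of_real (- 1) \<cdot>\<^sub>m A"
  have HN: "hermitian_mat n N" unfolding N_def by (rule hermitian_mat_smult[OF H])
  obtain r where r: "loewner_le n (complex_of_real r \<cdot>\<^sub>m 1\<^sub>m n) N" "eigenvalue N (complex_of_real r)"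
    using rayleigh_infimum_eigenvalue[OF HN n] .
  obtain v where v: "v \<in> carrier_vec n" "v \<noteq> 0\<^sub>v n" "N *\<^sub>v v = complex_of_real r \<cdot>\<^sub>v v"
    using hermitian_eigenvalueE[OF HN r(2)] by metis
  have "A *\<^sub>v v = complex_of_real (- r) \<cdot>\<^sub>v v"
  proof (rule eq_vecI)
    fix i assume "i < dim_vec (complex_of_real (- r) \<cdot>\<^sub>v v)"
    then have i: "i < n" using v(1) by simp
    then have "- vec_index (A *\<^sub>v v) i = complex_of_real r * vec_index v i"
      using arg_cong[OF v(3), of "\<lambda>w. vec_index w i"] v(1) A by (simp add: N_def)
    then have "vec_index (A *\<^sub>v v) i = - (complex_of_real r * vec_index v i)"
      by (metis add.inverse_inverse)
    then show "vec_index (A *\<^sub>v v) i = vec_index (complex_of_real (- r) \<cdot>\<^sub>v v) i"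
      using i v(1) by (simp)
  qed (use A v(1) in simp)
  then have "eigenvalue A (complex_of_real (- r))"
    unfolding eigenvalue_def eigenvector_def using A v(1,2) by auto
  then have t: "- r \<in> set es" by (simp add: ev)
  have "loewner_le n A (complex_of_real (- r) \<cdot>\<^sub>m 1\<^sub>m n)"
    unfolding loewner_le_iff[OF H hermitian_mat_one]
  proof
    fix w :: "complex Matrix.vec" assume w: "w \<in> carrier_vec n"
    have "r * Re (w \<bullet>c w) \<le> - 1 * Re ((A *\<^sub>v w) \<bullet>c w)"
      using r(1) w unfolding loewner_le_iff[OF hermitian_mat_one HN]
      unfolding N_def by (metis one_mat_quadratic_form smult_mat_quadratic_form[OF A])
    then show "Re ((A *\<^sub>v w) \<bullet>c w) \<le> Re (((complex_of_real (- r) \<cdot>\<^sub>m 1\<^sub>m n) *\<^sub>v w) \<bullet>c w)"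
      unfolding one_mat_quadratic_form[OF w] by simp
  qed
  then show thesis
    using that[of "prod_list es" s "- r"] es s(1) bounds[OF t] bounds[OF \<open>s \<in> set es\<close>]
      prod_list_bounds_member(1)[OF less_imp_le[OF m] bounds t]
      prod_list_bounds_member(2)[OF less_imp_le[OF m] bounds \<open>s \<in> set es\<close>] by simp
qed

section \<open>Positive unital maps and the final estimate\<close>

lemma positive_map_loewner:
  assumes lin: "linear_mat_map n k \<Phi>" and pos: "positive_mat_map n k \<Phi>"
    and le: "loewner_le n X Y" and HX: "hermitian_mat k (\<Phi> X)" and HY: "hermitian_mat k (\<Phi> Y)"
  shows "loewner_le k (\<Phi> X) (\<Phi> Y)"
proof -
  have X: "X \<in> carrier_mat n n" and Y: "Y \<in> carrier_mat n n" and P: "psd_mat n (Y - X)"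
    using le by (auto simp: loewner_le_def hermitian_mat_def)
  \<comment> \<open>\<open>linear_mat_map\<close> speaks of sums and scalar multiples only, so the
    difference is rewritten in those terms.\<close>
  have eq: "Y - X = Y + (- 1) \<cdot>\<^sub>m X" using X Y by (intro eq_matI) auto
  have "\<Phi> (Y - X) = \<Phi> Y + (- 1) \<cdot>\<^sub>m \<Phi> X"
    unfolding eq using lin X Y by (simp add: linear_mat_map_def)
  also have "\<dots> = \<Phi> Y - \<Phi> X"
    using lin X Y by (intro eq_matI) (auto simp: linear_mat_map_def)
  finally show ?thesis
    using pos P HX HY unfolding loewner_le_def positive_mat_map_def by metis
qed

lemma powr_root_split:
  assumes "0 < x" "0 < n"
  shows "x powr (1 / real n) * x powr ((real n - 1) / real n) = x"
  using assms by (simp add: powr_add[symmetric] add_divide_distrib[symmetric])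

lemma power_powr_root:
  assumes "0 < x" "0 < n"
  shows "(x ^ (n - 1)) powr (1 / real n) = x powr ((real n - 1) / real n)"
  using assms by (simp add: powr_realpow[symmetric] powr_powr of_nat_diff)

theorem theorem3p3:
  fixes n k :: nat and \<Phi> :: "complex mat \<Rightarrow> complex mat" and A :: "complex mat"
    and m M :: real
  assumes "1 \<le> n" and "1 \<le> k"
    and "linear_mat_map n k \<Phi>" and "positive_mat_map n k \<Phi>" and "unital_mat_map n k \<Phi>"
    and "pd_mat n A"
    and "0 < m" and "m \<le> M"
    and "loewner_le n (complex_of_real m \<cdot>\<^sub>m 1\<^sub>m n) A"
    and "loewner_le n A (complex_of_real M \<cdot>\<^sub>m 1\<^sub>m n)"
  shows "loewner_le k (complex_of_real ((m / M) powr ((real n - 1) / real n)) \<cdot>\<^sub>m 1\<^sub>m k)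
           ((det A powr (- (1 / of_nat n))) \<cdot>\<^sub>m \<Phi> A)
       \<and> loewner_le k ((det A powr (- (1 / of_nat n))) \<cdot>\<^sub>m \<Phi> A)
           (complex_of_real ((M / m) powr ((real n - 1) / real n)) \<cdot>\<^sub>m 1\<^sub>m k)"
proof -
  have n: "0 < n" and M: "0 < M" using assms by auto
  note m = \<open>0 < m\<close>
  define a where "a = (real n - 1) / real n"
  have a: "0 \<le> a" using n by (simp add: a_def)
  obtain d s t where det: "det A = complex_of_real d" and st: "m \<le> s" "m \<le> t" "t \<le> M"
    and s: "loewner_le n (complex_of_real s \<cdot>\<^sub>m 1\<^sub>m n) A"
    and t: "loewner_le n A (complex_of_real t \<cdot>\<^sub>m 1\<^sub>m n)"
    and d: "d \<le> s * M ^ (n - 1)" "t * m ^ (n - 1) \<le> d"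
    using extreme_eigenvalues_det_bounds[OF n m assms(9,10)] by metis
  have "0 < s" "0 < t" using st m by auto
  then have d0: "0 < d" using d(2) m by (meson less_le_trans mult_pos_pos zero_less_power)
  define c where "c = d powr (- (1 / real n))"
  have c0: "0 < c" using d0 by (simp add: c_def)
  \<comment> \<open>The complex power of the determinant agrees with the real one because
    \<open>d\<close> is positive.\<close>
  have c: "det A powr (- (1 / of_nat n)) = complex_of_real c"
    using powr_of_real[of d "- (1 / real n)"] d0 by (simp add: det c_def)
  have cd: "c * d powr (1 / real n) = 1"
    using d0 by (simp add: c_def powr_minus)
  have "psd_mat n A"
    unfolding psd_mat_def
  proof (intro conjI ballI)
    show H: "hermitian_mat n A" using assms(6) by (simp add: pd_mat_def)
    fix v :: "complex Matrix.vec" assume "v \<in> carrier_vec n"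
    then show "0 \<le> Re ((A *\<^sub>v v) \<bullet>c v)"
      using assms(6) H by (cases "v = 0\<^sub>v n") (auto simp: pd_mat_def hermitian_mat_def less_imp_le)
  qed
  then have HP: "hermitian_mat k (\<Phi> A)"
    using assms(4) by (simp add: positive_mat_map_def psd_mat_def)
  have P: "\<Phi> A \<in> carrier_mat k k" using HP by (simp add: hermitian_mat_def)
  have one: "\<Phi> (complex_of_real r \<cdot>\<^sub>m 1\<^sub>m n) = complex_of_real r \<cdot>\<^sub>m 1\<^sub>m k" for r
    using assms(3,5) by (simp add: linear_mat_map_def unital_mat_map_def)
  \<comment> \<open>Unitality sends scalar matrices to the same scalars, so the bounds
    \<open>s\<close> and \<open>t\<close> carry over from \<open>A\<close> to
    \<open>\<Phi> A\<close>.\<close>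
  have lo: "s * Re (v \<bullet>c v) \<le> Re ((\<Phi> A *\<^sub>v v) \<bullet>c v)"
    and up: "Re ((\<Phi> A *\<^sub>v v) \<bullet>c v) \<le> t * Re (v \<bullet>c v)" if v: "v \<in> carrier_vec k" for v
    using positive_map_loewner[OF assms(3,4) s] positive_map_loewner[OF assms(3,4) t] v
    by (auto simp: one HP hermitian_mat_one loewner_le_iff one_mat_quadratic_form)
  \<comment> \<open>After the root, multiplying by \<open>c\<close> cancels \<open>d\<close>; a
    further factor \<open>s powr a\<close> completes \<open>s powr (1 / n)\<close> to
    \<open>s\<close>, since \<open>1 / n + a = 1\<close>. The result is
    \<open>(s / M) powr a \<le> c * s\<close>.\<close>
  have "d powr (1 / real n) \<le> (s * M ^ (n - 1)) powr (1 / real n)"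
    using d(1) d0 by (intro powr_mono2) auto
  also have "\<dots> = s powr (1 / real n) * M powr a"
    using \<open>0 < s\<close> M n by (simp add: powr_mult power_powr_root a_def del: One_nat_def)
  finally have "1 \<le> c * (s powr (1 / real n) * M powr a)"
    using cd c0 by (metis mult_left_mono less_imp_le)
  then have "1 * s powr a \<le> c * (s powr (1 / real n) * M powr a) * s powr a"
    by (rule mult_right_mono) simp
  also have "\<dots> = c * s * M powr a"
    using powr_root_split[OF \<open>0 < s\<close> n] by (simp add: a_def mult.assoc mult.left_commute mult.commute)
  finally have "(s / M) powr a \<le> c * s"
    using \<open>0 < s\<close> M by (simp add: powr_divide pos_divide_le_eq)
  \<comment> \<open>Because \<open>a\<close> is nonnegative, \<open>s\<close> may be replaced by its
    lower bound \<open>m\<close>.\<close>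
  moreover have "(m / M) powr a \<le> (s / M) powr a"
    using a st m M by (intro powr_mono2) (auto simp: divide_right_mono)
  ultimately have cs: "(m / M) powr a \<le> c * s" by simp
  \<comment> \<open>The mirror image of the argument for \<open>s\<close>, with the lower bound of
    \<open>d\<close>, leads to \<open>c * t \<le> (t / m) powr a\<close>; then
    \<open>t \<le> M\<close> is used.\<close>
  have "t powr (1 / real n) * m powr a = (t * m ^ (n - 1)) powr (1 / real n)"
    using \<open>0 < t\<close> m n by (simp add: powr_mult power_powr_root a_def del: One_nat_def)
  also have "\<dots> \<le> d powr (1 / real n)"
    using d(2) \<open>0 < t\<close> m by (intro powr_mono2) auto
  finally have "c * (t powr (1 / real n) * m powr a) \<le> 1"
    using cd c0 by (metis mult_left_mono less_imp_le)
  then have "c * (t powr (1 / real n) * m powr a) * t powr a \<le> 1 * t powr a"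
    by (rule mult_right_mono) simp
  moreover have "c * (t powr (1 / real n) * m powr a) * t powr a = c * t * m powr a"
    using powr_root_split[OF \<open>0 < t\<close> n] by (simp add: a_def mult.assoc mult.left_commute mult.commute)
  ultimately have "c * t \<le> (t / m) powr a"
    using \<open>0 < t\<close> m by (simp add: powr_divide pos_le_divide_eq)
  also have "\<dots> \<le> (M / m) powr a"
    using a st m \<open>0 < t\<close> by (intro powr_mono2) (auto simp: divide_right_mono)
  finally have ct: "c * t \<le> (M / m) powr a" .
  note iffs = loewner_le_iff[OF hermitian_mat_one hermitian_mat_smult[OF HP]]
    loewner_le_iff[OF hermitian_mat_smult[OF HP] hermitian_mat_one]
  show ?thesis
    unfolding c a_def[symmetric] iffs
  proof (intro conjI ballI)
    fix v :: "complex Matrix.vec" assume v: "v \<in> carrier_vec k"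
    note forms = one_mat_quadratic_form[OF v] smult_mat_quadratic_form[OF P v]
    have "(m / M) powr a * Re (v \<bullet>c v) \<le> c * s * Re (v \<bullet>c v)"
      using cs Re_cscalar_self_nonneg[OF v] by (rule mult_right_mono)
    also have "\<dots> \<le> c * Re ((\<Phi> A *\<^sub>v v) \<bullet>c v)"
      using lo[OF v] c0 by (simp add: mult.assoc)
    finally show "Re (((complex_of_real ((m / M) powr a) \<cdot>\<^sub>m 1\<^sub>m k) *\<^sub>v v) \<bullet>c v)
        \<le> Re (((complex_of_real c \<cdot>\<^sub>m \<Phi> A) *\<^sub>v v) \<bullet>c v)" unfolding forms .
    have "c * Re ((\<Phi> A *\<^sub>v v) \<bullet>c v) \<le> c * t * Re (v \<bullet>c v)"
      using up[OF v] c0 by (simp add: mult.assoc)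
    also have "\<dots> \<le> (M / m) powr a * Re (v \<bullet>c v)"
      using ct Re_cscalar_self_nonneg[OF v] by (rule mult_right_mono)
    finally show "Re (((complex_of_real c \<cdot>\<^sub>m \<Phi> A) *\<^sub>v v) \<bullet>c v)
        \<le> Re (((complex_of_real ((M / m) powr a) \<cdot>\<^sub>m 1\<^sub>m k) *\<^sub>v v) \<bullet>c v)" unfolding forms .
  qed
qed

end
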